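(* Let $A=\{\mathbf{a}_1,\dots,\mathbf{a}_n\}\subseteq\mathbb{Z}^d$, $\beta\in\mathbb{C}^d$, let $v=(v_1,\dots,v_n)\in\mathbb{C}^n$ satisfy $\sum_{i=1}^n v_i\mathbf{a}_i=\beta$, let $u\in\mathbb{Z}A$ and let $r\ge0$ be an integer. Suppose that $v$ has minimal $(I,u)$-negative support for all $I\subseteq\{1,\dots,n\}$ with $|I|\ge n-r$, and let $l^{(k)}=(l^{(k)}_1,\dots,l^{(k)}_n)\in L$ for $k=1,\dots,r$. Then the expression $$\sum_{P=(p_1,\dots,p_r)\in\mathcal{P}_r} l^{(1)}_{p_1}\cdots l^{(r)}_{p_r}\,\Psi^P_{v,\beta+u}(x)$$ is a (formal) solution of the $A$-hypergeometric system with parameter $\beta+u$.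
   Context: $\mathbb{Z}A$ is the abelian group generated by $A$. $L=\{l\in\mathbb{Z}^n\mid\sum_{j=1}^n l_j\mathbf{a}_j=\mathbf{0}\}$ and, for $u\in\mathbb{Z}A$, $L(u)=\{l\in\mathbb{Z}^n\mid\sum_{j=1}^n l_j\mathbf{a}_j=u\}$. The $A$-hypergeometric system with parameter $\gamma=(\gamma_1,\dots,\gamma_d)\in\mathbb{C}^d$ consists of the box operators $\Box_l=\prod_{l_j>0}\partial_j^{l_j}-\prod_{l_j<0}\partial_j^{-l_j}$ for $l\in L$, and the Euler operators $\sum_{j=1}^n a_{ij}x_j\partial_j-\gamma_i$, $i=1,\dots,d$, where $\mathbf{a}_j=(a_{1j},\dots,a_{dj})$ and $\partial_j=\partial/\partial x_j$. A solution is an expression annihilated by all these operators; operators act on formal series termwise. For $I\subseteq\{1,\dots,n\}$ and $w\in\mathbb{C}^n$, $I\text{-nsupp}(w)=\{i\in I\mid w_i\in\mathbb{Z}_{<0}\}$. The vector $v$ has minimal $(I,u)$-negative support if $I\text{-nsupp}(v+l)$ is not a proper subset of $I\text{-nsupp}(v)$ for any $l\in L(u)$. For $c\in\mathbb{C}$ and $r\in\mathbb{Z}_{\ge0}$, $\{f^{(c,r)}_l(t)\}_{l\in\mathbb{Z}}$ is the sequence of functions of one variable $t$ such that $f^{(c,r)}_0(t)=t^c\log^r t$, $\frac{d}{dt}f^{(c,r)}_l(t)=f^{(c,r)}_{l-1}(t)$ for all $l\in\mathbb{Z}$, and $f^{(c,r)}_l(t)$ is $t^{c+l}$ times a polynomial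 in $\log t$ with constant coefficients; for $l<0$ these are obtained by differentiating $-l$ times, and for $l>0$ by integrating $l$ times, taking the constant of integration to be $0$ each time (so when $l>0$ and $c+l=0$ the polynomial in $\log t$ has zero constant term). For an integer $r\ge 0$, $\mathcal{P}_r=\{1,\dots,n\}^r$ is the set of sequences of length $r$ from $\{1,\dots,n\}$ ($\mathcal{P}_0=\{\emptyset\}$). For $P=(p_1,\dots,p_r)\in\mathcal{P}_r$ put $\rho_P(i)=\mathrm{card}\{j\mid p_j=i\}$. Then $\Psi^P_{v,\beta+u}(x)$ is the formal series $$\Psi^P_{v,\beta+u}(x)=\sum_{l\in L(u)}\prod_{i=1}^n f^{(v_i,\rho_P(i))}_{l_i}(x_i),$$ i.e. a formal sum over $l\in L(u)$ of monomials $x^{v+l}$ times polynomials in $\log x_1,\dots,\log x_n$. *)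

theory Defs
  imports
    "HOL-Analysis.Analysis"
    "HOL-Computational_Algebra.Polynomial"
    "HOL-Computational_Algebra.Group_Closure"
begin

definition vec_of_int :: "int ^ 'm \<Rightarrow> complex ^ 'm" where
  "vec_of_int l = (\<chi> i. of_int (l $ i))"

text \<open>\<open>relation_set a u\<close> is \<open>L(u)\<close>; the lattice \<open>L\<close> is \<open>relation_set a 0\<close>.\<close>

definition relation_set :: "('n::finite \<Rightarrow> int ^ 'd) \<Rightarrow> int ^ 'd \<Rightarrow> (int ^ 'n) set" where
  "relation_set a u = {l. (\<Sum>j\<in>UNIV. l $ j *s a j) = u}"

definition nsupp :: "'n set \<Rightarrow> complex ^ 'n \<Rightarrow> 'n set" where
  "nsupp I w = {i \<in> I. \<exists>m::int. m < 0 \<and> w $ i = of_int m}"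

definition minimal_neg_support ::
  "('n::finite \<Rightarrow> int ^ 'd) \<Rightarrow> 'n set \<Rightarrow> int ^ 'd \<Rightarrow> complex ^ 'n \<Rightarrow> bool" where
  "minimal_neg_support a I u v \<longleftrightarrow>
     (\<forall>l \<in> relation_set a u. \<not> nsupp I (v + vec_of_int l) \<subset> nsupp I v)"

text \<open>A polynomial \<open>p\<close> together with an exponent \<open>e\<close> stands for the function \<open>t\<^sup>e p(log t)\<close>.
  Its derivative is \<open>t\<^sup>e\<^sup>-\<^sup>1\<close> times \<open>log_deriv e p\<close> evaluated at \<open>log t\<close>.\<close>

definition log_deriv :: "complex \<Rightarrow> complex poly \<Rightarrow> complex poly" where
  "log_deriv e p = smult e p + pderiv p"

lemma log_deriv_correct:
  assumes "t \<notin> \<real>\<^sub>\<le>\<^sub>0"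
  shows "((\<lambda>t. t powr e * poly p (Ln t)) has_field_derivative
            t powr (e - 1) * poly (log_deriv e p) (Ln t)) (at t)"
proof -
  have t: "t \<noteq> 0" using assms by auto
  have "((\<lambda>t. t powr e * poly p (Ln t)) has_field_derivative
          (e * t powr (e - 1)) * poly p (Ln t) + (poly (pderiv p) (Ln t) * inverse t) * t powr e) (at t)"
    by (intro DERIV_mult has_field_derivative_powr DERIV_chain2[OF poly_DERIV]
          has_field_derivative_Ln assms)
  moreover have "t powr (e - 1) = t powr e * inverse t"
    using t by (simp add: powr_diff divide_inverse)
  ultimately show ?thesis
    by (simp add: log_deriv_def algebra_simps)
qed

lemma log_deriv_diff: "log_deriv e (p - q) = log_deriv e p - log_deriv e q"
  by (simp add: log_deriv_def smult_diff_right pderiv_diff)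

lemma log_deriv_eq_0:
  assumes "log_deriv e p = 0" and "e = 0 \<longrightarrow> coeff p 0 = 0"
  shows "p = 0"
proof (cases "e = 0")
  case True
  then have "pderiv p = 0" using assms by (simp add: log_deriv_def)
  then have "degree p = 0" by (simp add: pderiv_eq_0_iff)
  then obtain c where "p = [:c:]" by (rule degree_eq_zeroE)
  then show ?thesis using assms True by simp
next
  case False
  have eq: "smult e p = - pderiv p"
    using assms by (simp add: log_deriv_def eq_neg_iff_add_eq_0)
  have "degree (smult e p) = degree (pderiv p)" by (simp only: eq degree_minus)
  then have "degree p = degree p - 1" using False by (simp add: degree_pderiv)
  then have "degree p = 0" by simp
  then have "pderiv p = 0" by (simp add: pderiv_eq_0_iff)
  then show ?thesis using eq False by simp
qed

lemma log_deriv_surj_nonzero: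
  assumes "e \<noteq> 0"
  shows "\<exists>q. log_deriv e q = p"
proof (induction "degree p" arbitrary: p rule: less_induct)
  case less
  show ?case
  proof (cases "degree p = 0")
    case True
    then have "pderiv p = 0" by (simp add: pderiv_eq_0_iff)
    then have "log_deriv e (smult (1 / e) p) = p"
      using assms by (simp add: log_deriv_def pderiv_smult)
    then show ?thesis ..
  next
    case False
    then have "degree (pderiv p) < degree p" by (simp add: degree_pderiv)
    then obtain s where s: "log_deriv e s = pderiv p" using less by blast
    have "log_deriv e (smult (1 / e) (p - s)) = p"
      using assms s[symmetric]
      by (simp add: log_deriv_def pderiv_smult pderiv_diff)
    then show ?thesis ..
  qed
qed

lemma log_deriv_surj_zero: "\<exists>q. log_deriv 0 q = p \<and> coeff q 0 = 0"
proof
  let ?q = "\<Sum>k\<le>degree p. monom (coeff p k / of_nat (Suc k)) (Suc k)"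
  have pderiv_sum: "pderiv (\<Sum>k\<le>n. f k) = (\<Sum>k\<le>n. pderiv (f k))"
    for f :: "nat \<Rightarrow> complex poly" and n
    by (induction n) (simp_all add: pderiv_add)
  have "pderiv ?q = (\<Sum>k\<le>degree p. monom (coeff p k) k)"
    unfolding pderiv_sum by (rule sum.cong) (simp_all add: pderiv_monom del: of_nat_Suc)
  also have "\<dots> = p" by (rule poly_as_sum_of_monoms)
  finally have "pderiv ?q = p" .
  then show "log_deriv 0 ?q = p \<and> coeff ?q 0 = 0"
    by (simp add: log_deriv_def coeff_sum)
qed

lemma ex1_log_integral: "\<exists>!q. log_deriv e q = p \<and> (e = 0 \<longrightarrow> coeff q 0 = 0)"
proof (rule ex_ex1I)
  show "\<exists>q. log_deriv e q = p \<and> (e = 0 \<longrightarrow> coeff q 0 = 0)"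
  proof (cases "e = 0")
    case True
    then show ?thesis using log_deriv_surj_zero[of p] by blast
  next
    case False
    then show ?thesis using log_deriv_surj_nonzero[of e p] by blast
  qed
next
  fix q s
  assume "log_deriv e q = p \<and> (e = 0 \<longrightarrow> coeff q 0 = 0)"
    and "log_deriv e s = p \<and> (e = 0 \<longrightarrow> coeff s 0 = 0)"
  then have "q - s = 0"
    by (intro log_deriv_eq_0[of e "q - s"]) (simp_all add: log_deriv_diff)
  then show "q = s" by simp
qed

text \<open>Integration of \<open>t\<^sup>e\<^sup>-\<^sup>1 p(log t)\<close> with constant of integration 0. For \<open>e \<noteq> 0\<close> the form
  \<open>t\<^sup>e q(log t)\<close> of the result already determines it; for \<open>e = 0\<close> the constant of integration is
  the constant term of \<open>q\<close>.\<close>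

definition log_integral :: "complex \<Rightarrow> complex poly \<Rightarrow> complex poly" where
  "log_integral e p = (THE q. log_deriv e q = p \<and> (e = 0 \<longrightarrow> coeff q 0 = 0))"

lemma log_deriv_log_integral: "log_deriv e (log_integral e p) = p"
  and coeff_log_integral: "coeff (log_integral 0 p) 0 = 0"
  using theI'[OF ex1_log_integral[of e p]] theI'[OF ex1_log_integral[of 0 p]]
  unfolding log_integral_def by simp_all

primrec f_poly_up :: "complex \<Rightarrow> nat \<Rightarrow> nat \<Rightarrow> complex poly" where
  "f_poly_up c r 0 = monom 1 r"
| "f_poly_up c r (Suc m) = log_integral (c + of_nat (Suc m)) (f_poly_up c r m)"

primrec f_poly_down :: "complex \<Rightarrow> nat \<Rightarrow> nat \<Rightarrow> complex poly" where
  "f_poly_down c r 0 = monom 1 r"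
| "f_poly_down c r (Suc m) = log_deriv (c - of_nat m) (f_poly_down c r m)"

text \<open>\<open>f\<^sub>l(t) = t\<^sup>c\<^sup>+\<^sup>l g(log t)\<close> where \<open>f\<^sub>l\<close> is the function attached to \<open>(c, r)\<close> and
  \<open>g = f_poly c r l\<close>.\<close>

definition f_poly :: "complex \<Rightarrow> nat \<Rightarrow> int \<Rightarrow> complex poly" where
  "f_poly c r l = (if l \<ge> 0 then f_poly_up c r (nat l) else f_poly_down c r (nat (- l)))"

definition f_fun :: "complex \<Rightarrow> nat \<Rightarrow> int \<Rightarrow> complex \<Rightarrow> complex" where
  "f_fun c r l t = t powr (c + of_int l) * poly (f_poly c r l) (Ln t)"

lemma f_poly_0: "f_poly c r 0 = monom 1 r"
  by (simp add: f_poly_def)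

lemma log_deriv_f_poly: "log_deriv (c + of_int l) (f_poly c r l) = f_poly c r (l - 1)"
proof (cases "l > 0")
  case True
  define m where "m = nat (l - 1)"
  have l: "l = int (Suc m)" using True by (simp add: m_def)
  have "f_poly c r l = log_integral (c + of_int l) (f_poly_up c r m)"
    by (simp add: f_poly_def l nat_add_distrib add_ac)
  moreover have "f_poly c r (l - 1) = f_poly_up c r m"
    by (simp add: f_poly_def l)
  ultimately show ?thesis by (simp add: log_deriv_log_integral)
next
  case False
  define m where "m = nat (- l)"
  have l: "l = - int m" using False by (simp add: m_def)
  have "f_poly c r (l - 1) = f_poly_down c r (Suc m)"
    by (simp add: f_poly_def l nat_add_distrib)
  moreover have "f_poly c r l = f_poly_down c r m"
    by (cases "m = 0") (simp_all add: f_poly_def l)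
  ultimately show ?thesis by (simp add: l)
qed

lemma coeff_0_f_poly:
  assumes "l > 0" and "c + of_int l = 0"
  shows "coeff (f_poly c r l) 0 = 0"
proof -
  define m where "m = nat (l - 1)"
  have l: "l = int (Suc m)" using assms by (simp add: m_def)
  have "f_poly c r l = log_integral (c + of_int l) (f_poly_up c r m)"
    by (simp add: f_poly_def l nat_add_distrib add_ac)
  then show ?thesis using assms by (simp add: coeff_log_integral)
qed

text \<open>The defining properties of the sequence, for actual functions and the principal branch.\<close>

lemma f_fun_0: "f_fun c r 0 t = t powr c * Ln t ^ r"
  by (simp add: f_fun_def f_poly_0 poly_monom)

lemma f_fun_deriv:
  assumes "t \<notin> \<real>\<^sub>\<le>\<^sub>0"
  shows "(f_fun c r l has_field_derivative f_fun c r (l - 1) t) (at t)"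
proof -
  have "f_fun c r l = (\<lambda>t. t powr (c + of_int l) * poly (f_poly c r l) (Ln t))"
    by (simp add: fun_eq_iff f_fun_def)
  then show ?thesis
    using log_deriv_correct[OF assms, of "c + of_int l" "f_poly c r l"]
    by (simp add: f_fun_def log_deriv_f_poly algebra_simps)
qed

text \<open>A formal series \<open>F\<close> is given by its coefficients: \<open>F w k\<close> belongs to
  \<open>x\<^sub>1\<^bsup>w\<^sub>1\<^esup> \<cdots> x\<^sub>n\<^bsup>w\<^sub>n\<^esup> (log x\<^sub>1)\<^bsup>k\<^sub>1\<^esup> \<cdots> (log x\<^sub>n)\<^bsup>k\<^sub>n\<^esup>\<close>. The proper objects, for which
  each \<open>x\<^sup>w\<close> is multiplied by a polynomial in the logarithms, satisfy \<open>poly_in_logs\<close>.\<close>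

type_synonym 'n logseries = "complex ^ 'n \<Rightarrow> nat ^ 'n \<Rightarrow> complex"

definition poly_in_logs :: "('n::finite) logseries \<Rightarrow> bool" where
  "poly_in_logs F \<longleftrightarrow> (\<forall>w. finite {k. F w k \<noteq> 0})"

text \<open>Termwise \<open>\<partial>\<^sub>j\<close>. A term \<open>x\<^sup>w (log x)\<^sup>k\<close> contributes \<open>w\<^sub>j\<close> at \<open>(w - e\<^sub>j, k)\<close> and \<open>k\<^sub>j\<close> at
  \<open>(w - e\<^sub>j, k - e\<^sub>j)\<close>; hence every coefficient of the derivative is a sum of two terms.\<close>

definition partial :: "'n \<Rightarrow> ('n::finite) logseries \<Rightarrow> 'n logseries" where
  "partial j F w k =
     (w $ j + 1) * F (w + axis j 1) k + of_nat (k $ j + 1) * F (w + axis j 1) (k + axis j 1)"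

definition mult_x :: "'n \<Rightarrow> ('n::finite) logseries \<Rightarrow> 'n logseries" where
  "mult_x j F w k = F (w - axis j 1) k"

lemma partial_commute: "partial i (partial j F) = partial j (partial i F)"
proof (cases "i = j")
  case False
  then show ?thesis
    by (auto simp: fun_eq_iff partial_def axis_def algebra_simps)
qed simp

text \<open>\<open>\<Prod>\<^sub>j \<partial>\<^sub>j\<^bsup>m\<^sub>j\<^esup>\<close>. The order of the factors is irrelevant by the next lemma.\<close>

definition partial_power :: "nat ^ 'n \<Rightarrow> ('n::finite) logseries \<Rightarrow> 'n logseries" where
  "partial_power m F = Finite_Set.fold (\<lambda>j. partial j ^^ (m $ j)) F UNIV"

lemma partial_power_comp_fun_commute:
  "comp_fun_commute (\<lambda>j. (partial j :: ('n::finite) logseries \<Rightarrow> _) ^^ (m $ j))"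
proof
  have one: "partial i ((partial j ^^ b) F) = (partial j ^^ b) (partial i F)"
    for i j :: 'n and b F
    by (induction b) (simp_all add: partial_commute[of i])
  have "(partial i ^^ a) ((partial j ^^ b) F) = (partial j ^^ b) ((partial i ^^ a) F)"
    for i j :: 'n and a b F
    by (induction a) (simp_all add: one)
  then show "(partial j ^^ (m $ j)) \<circ> (partial i ^^ (m $ i)) =
      (partial i ^^ (m $ i)) \<circ> (partial j ^^ (m $ j))" for i j :: 'n
    by (simp add: fun_eq_iff comp_def)
qed

definition box_op :: "int ^ 'n \<Rightarrow> ('n::finite) logseries \<Rightarrow> 'n logseries" where
  "box_op l F w k =
     partial_power (\<chi> j. nat (l $ j)) F w k - partial_power (\<chi> j. nat (- (l $ j))) F w k"

definition euler_op ::
  "('n::finite \<Rightarrow> int ^ 'd) \<Rightarrow> complex ^ 'd \<Rightarrow> 'd \<Rightarrow> 'n logseries \<Rightarrow> 'n logseries" where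
  "euler_op a \<gamma> i F w k =
     (\<Sum>j\<in>UNIV. of_int (a j $ i) * mult_x j (partial j F) w k) - \<gamma> $ i * F w k"

definition hypergeometric_solution ::
  "('n::finite \<Rightarrow> int ^ 'd) \<Rightarrow> complex ^ 'd \<Rightarrow> 'n logseries \<Rightarrow> bool" where
  "hypergeometric_solution a \<gamma> F \<longleftrightarrow>
     poly_in_logs F \<and>
     (\<forall>l \<in> relation_set a 0. \<forall>w k. box_op l F w k = 0) \<and>
     (\<forall>i w k. euler_op a \<gamma> i F w k = 0)"

text \<open>\<open>\<rho>\<^sub>P(i)\<close> is \<open>count_list P i\<close>. For given \<open>w\<close> at most one \<open>l\<close> satisfies \<open>v + l = w\<close>,
  so the sum below is finite.\<close>

definition Psi ::
  "('n::finite \<Rightarrow> int ^ 'd) \<Rightarrow> complex ^ 'n \<Rightarrow> int ^ 'd \<Rightarrow> 'n list \<Rightarrow> 'n logseries" where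
  "Psi a v u P w k =
     (\<Sum>l | l \<in> relation_set a u \<and> v + vec_of_int l = w.
        \<Prod>i\<in>UNIV. coeff (f_poly (v $ i) (count_list P i) (l $ i)) (k $ i))"

lemma Psi_index_finite: "finite {l. l \<in> relation_set a u \<and> v + vec_of_int l = w}"
proof (rule finite_subset)
  show "{l. l \<in> relation_set a u \<and> v + vec_of_int l = w} \<subseteq> {THE l. v + vec_of_int l = w}"
  proof
    fix l assume "l \<in> {l. l \<in> relation_set a u \<and> v + vec_of_int l = w}"
    then have l: "v + vec_of_int l = w" by simp
    have "m = l" if "v + vec_of_int m = w" for m
    proof -
      have "vec_of_int m = vec_of_int l" using that l by (metis add_left_cancel)
      then show ?thesis by (simp add: vec_eq_iff vec_of_int_def)
    qed
    then have "(THE l. v + vec_of_int l = w) = l" using l by (intro the_equality)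
    then show "l \<in> {THE l. v + vec_of_int l = w}" by simp
  qed
qed simp

end

theory Submission
  imports Defs
begin

text \<open>
  Since \<open>f\<^sub>l' = f\<^sub>l\<^sub>-\<^sub>1\<close> holds without exception, \<open>\<partial>\<^sub>j\<close> carries the series \<open>\<Psi>\<^sup>P\<close> over \<open>L(u)\<close> to the one
  over \<open>L(u - a\<^sub>j)\<close> (\<open>partial_Psi\<close>). For \<open>l \<in> L\<close> the two monomials in the box operator
  shift \<open>u\<close> by the same vector, so the box operators annihilate each \<open>\<Psi>\<^sup>P\<close> separately.

  The Euler operators need the hypotheses. As \<open>x \<partial>/\<partial>x\<close> acts on \<open>x\<^sup>e p(log x)\<close> as
  \<open>e + \<partial>/\<partial>log x\<close>, and \<open>\<Sum>\<^sub>j (v\<^sub>j + l\<^sub>j) a\<^sub>j = \<beta> + u\<close> for \<open>l \<in> L(u)\<close>, it must be shown that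
  \<open>\<Sum>\<^sub>j a\<^sub>j \<partial>/\<partial>log x\<^sub>j\<close> kills the logarithmic polynomial attached to each \<open>l\<close>. Suppose first that
  \<open>\<partial>/\<partial>log x\<close> sends \<open>f\<^bsup>(c,r)\<^esup>\<^sub>l\<close> to \<open>r f\<^bsup>(c,r-1)\<^esup>\<^sub>l\<close> for all the factors involved. Then differentiating
  amounts to deleting an entry of \<open>P\<close> in all possible ways, and summing over the value \<open>p\<close> of
  the deleted \<open>k\<close>-th entry produces the factor \<open>\<Sum>\<^sub>p l\<^bsup>(k)\<^esup>\<^sub>p a\<^sub>p = 0\<close>
  (\<open>sum_lists_delete_entry_eq_0\<close>).

  This differentiation rule fails only if an integration producing \<open>f\<^bsup>(c,r)\<^esup>\<^sub>l\<close> passes through exponent \<open>0\<close>,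
  that is, if \<open>c\<close> is a negative integer and \<open>c + l \<ge> 0\<close> (\<open>pderiv_f_poly\<close>). So let \<open>l \<in> L(u)\<close>
  be such that this occurs in some coordinate, and let \<open>Z\<close> be the set of coordinates that pass from
  \<open>v\<^sub>i \<ge> 0\<close> to \<open>v\<^sub>i + l\<^sub>i < 0\<close>. Off \<open>Z\<close> the negative support strictly shrinks, so minimality
  forces \<open>|Z| > r\<close> (\<open>card_new_negatives\<close>). But \<open>f\<^bsup>(c,0)\<^esup>\<^sub>l = 0\<close> for \<open>c \<ge> 0 > c + l\<close>, and a sequence of
  length \<open>r\<close> misses some element of \<open>Z\<close>; hence the contribution of \<open>l\<close> is zero.
\<close>

section \<open>The one-variable functions\<close>

lemma pderiv_log_deriv: "pderiv (log_deriv e p) = log_deriv e (pderiv p)"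
  by (simp add: log_deriv_def pderiv_add pderiv_smult)

lemma log_deriv_smult: "log_deriv e (smult c p) = smult c (log_deriv e p)"
  by (simp add: log_deriv_def pderiv_smult smult_add_right mult.commute)

lemma pderiv_f_poly_down:
  "pderiv (f_poly_down c r m) = smult (of_nat r) (f_poly_down c (r - 1) m)"
  by (induction m) (simp_all add: pderiv_monom smult_monom pderiv_log_deriv log_deriv_smult)

text \<open>Both sides have the same image under \<open>log_deriv\<close>; this determines them as long as no
  exponent met during the integrations is \<open>0\<close>.\<close>

lemma pderiv_f_poly_up:
  assumes "\<And>i. 0 < i \<Longrightarrow> i \<le> m \<Longrightarrow> c + of_nat i \<noteq> 0"
  shows "pderiv (f_poly_up c r m) = smult (of_nat r) (f_poly_up c (r - 1) m)"
  using assms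
proof (induction m)
  case 0
  show ?case by (simp add: pderiv_monom smult_monom)
next
  case (Suc m)
  let ?e = "c + of_nat (Suc m)"
  have IH: "pderiv (f_poly_up c r m) = smult (of_nat r) (f_poly_up c (r - 1) m)"
    using Suc by simp
  have "log_deriv ?e (pderiv (f_poly_up c r (Suc m))
          - smult (of_nat r) (f_poly_up c (r - 1) (Suc m))) = 0"
    by (simp add: log_deriv_diff log_deriv_smult log_deriv_log_integral IH
        flip: pderiv_log_deriv del: of_nat_Suc)
  moreover have "?e \<noteq> 0" using Suc.prems[of "Suc m"] by blast
  ultimately show ?case
    using log_deriv_eq_0 by (metis eq_iff_diff_eq_0)
qed

lemma pderiv_f_poly:
  assumes "\<And>m::int. c = of_int m \<Longrightarrow> m < 0 \<Longrightarrow> m + l < 0"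
  shows "pderiv (f_poly c r l) = smult (of_nat r) (f_poly c (r - 1) l)"
proof (cases "l \<ge> 0")
  case True
  have "c + of_nat i \<noteq> 0" if "0 < i" "i \<le> nat l" for i
  proof
    assume "c + of_nat i = 0"
    then have "c = of_int (- int i)" by (simp add: eq_neg_iff_add_eq_0)
    from assms[OF this] that True show False by linarith
  qed
  then show ?thesis using True by (simp add: f_poly_def pderiv_f_poly_up)
qed (simp add: f_poly_def pderiv_f_poly_down)

text \<open>Differentiating \<open>t\<^sup>c\<close> more than \<open>c\<close> times gives \<open>0\<close>.\<close>

lemma f_poly_no_log_eq_0:
  assumes "0 \<le> c" and "c + l < 0"
  shows "f_poly (of_int c) 0 l = 0"
proof -
  have "f_poly_down (of_int c) 0 (Suc (nat c) + k) = 0" for k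
  proof (induction k)
    case 0
    show ?case using assms(1) by (simp add: log_deriv_def pderiv_f_poly_down)
  qed (simp add: log_deriv_def)
  from this[of "nat (- l) - Suc (nat c)"] show ?thesis
    using assms by (simp add: f_poly_def)
qed

section \<open>Termwise derivatives and box operators\<close>

definition f_prod_coeff ::
  "complex ^ 'n \<Rightarrow> ('n \<Rightarrow> nat) \<Rightarrow> int ^ 'n \<Rightarrow> nat ^ 'n \<Rightarrow> complex" where
  "f_prod_coeff v \<rho> l k = (\<Prod>i\<in>UNIV. coeff (f_poly (v $ i) (\<rho> i) (l $ i)) (k $ i))"

lemma f_prod_coeff_remove:
  "f_prod_coeff v \<rho> l k =
     coeff (f_poly (v $ j) (\<rho> j) (l $ j)) (k $ j) *
     (\<Prod>i\<in>UNIV - {j}. coeff (f_poly (v $ i) (\<rho> i) (l $ i)) (k $ i))"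
  for v :: "complex ^ 'n::finite"
  unfolding f_prod_coeff_def by (rule prod.remove) simp_all

lemma Psi_altdef:
  "Psi a v u P w k =
     (\<Sum>l | l \<in> relation_set a u \<and> v + vec_of_int l = w. f_prod_coeff v (count_list P) l k)"
  by (simp add: Psi_def f_prod_coeff_def)

lemma vec_of_int_add: "vec_of_int (l + m) = vec_of_int l + vec_of_int m"
  by (simp add: vec_of_int_def vec_eq_iff)

lemma vec_of_int_diff: "vec_of_int (l - m) = vec_of_int l - vec_of_int m"
  by (simp add: vec_of_int_def vec_eq_iff)

lemma vec_of_int_axis: "vec_of_int (axis j 1) = axis j 1"
  by (simp add: vec_of_int_def vec_eq_iff axis_def)

lemma vec_of_int_inj: "vec_of_int l = vec_of_int m \<longleftrightarrow> l = m"
  by (simp add: vec_of_int_def vec_eq_iff)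

lemma Psi_at:
  assumes "l \<in> relation_set a u"
  shows "Psi a v u P (v + vec_of_int l) k = f_prod_coeff v (count_list P) l k"
proof -
  have "{m. m \<in> relation_set a u \<and> v + vec_of_int m = v + vec_of_int l} = {l}"
    using assms by (auto simp: vec_of_int_inj)
  then show ?thesis by (simp add: Psi_altdef)
qed

lemma Psi_outside:
  assumes "\<nexists>l. l \<in> relation_set a u \<and> w = v + vec_of_int l"
  shows "Psi a v u P w k = 0"
proof -
  have "{l. l \<in> relation_set a u \<and> v + vec_of_int l = w} = {}" using assms by auto
  then show ?thesis by (simp only: Psi_altdef sum.empty)
qed

lemma relation_set_add_axis:
  "l + axis j 1 \<in> relation_set a u \<longleftrightarrow> l \<in> relation_set a (u - a j)"
proof -
  have "(\<Sum>i\<in>UNIV. axis j 1 $ i *s a i) = a j"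
    by (subst sum.remove[of _ j]) (auto simp: axis_def intro!: sum.neutral)
  then have "(\<Sum>i\<in>UNIV. (l + axis j 1) $ i *s a i) = (\<Sum>i\<in>UNIV. l $ i *s a i) + a j"
    by (simp add: vector_sadd_rdistrib sum.distrib)
  then show ?thesis by (auto simp: relation_set_def algebra_simps)
qed

lemma partial_f_prod_coeff:
  "((v + vec_of_int l) $ j + 1) * f_prod_coeff v \<rho> (l + axis j 1) k
    + of_nat (k $ j + 1) * f_prod_coeff v \<rho> (l + axis j 1) (k + axis j 1)
   = f_prod_coeff v \<rho> l k"
proof -
  let ?R = "\<Prod>i\<in>UNIV - {j}. coeff (f_poly (v $ i) (\<rho> i) (l $ i)) (k $ i)"
  let ?p = "f_poly (v $ j) (\<rho> j) (l $ j + 1)"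
  have 1: "f_prod_coeff v \<rho> (l + axis j 1) k = coeff ?p (k $ j) * ?R"
    by (subst f_prod_coeff_remove[of _ _ _ _ j])
      (auto simp: axis_def intro!: arg_cong2[where f = "(*)"] prod.cong)
  have 2: "f_prod_coeff v \<rho> (l + axis j 1) (k + axis j 1) = coeff ?p (Suc (k $ j)) * ?R"
    by (subst f_prod_coeff_remove[of _ _ _ _ j])
      (auto simp: axis_def intro!: arg_cong2[where f = "(*)"] prod.cong)
  have "coeff (f_poly (v $ j) (\<rho> j) (l $ j)) (k $ j)
      = coeff (log_deriv (v $ j + of_int (l $ j + 1)) ?p) (k $ j)"
    by (simp only: log_deriv_f_poly add_diff_cancel_right')
  also have "\<dots> = ((v + vec_of_int l) $ j + 1) * coeff ?p (k $ j)
                    + of_nat (k $ j + 1) * coeff ?p (Suc (k $ j))"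
    by (simp add: log_deriv_def coeff_pderiv vec_of_int_def algebra_simps)
  finally show ?thesis
    unfolding f_prod_coeff_remove[of v \<rho> l k j] 1 2 by (simp only: distrib_right mult.assoc)
qed

lemma partial_Psi: "partial j (Psi a v u P) = Psi a v (u - a j) P"
proof (intro ext)
  fix w k
  let ?S = "{l. l \<in> relation_set a u \<and> v + vec_of_int l = w + axis j 1}"
  let ?c = "f_prod_coeff v (count_list P)"
  have "partial j (Psi a v u P) w k =
     (\<Sum>l\<in>?S. (w $ j + 1) * ?c l k + of_nat (k $ j + 1) * ?c l (k + axis j 1))"
    by (simp only: partial_def Psi_altdef sum.distrib sum_distrib_left)
  also have "\<dots> =
     (\<Sum>l | l \<in> relation_set a (u - a j) \<and> v + vec_of_int l = w. ?c l k)"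
  proof (rule sum.reindex_bij_witness[of _ "\<lambda>l. l + axis j 1" "\<lambda>l. l - axis j 1"])
    fix l assume l: "l \<in> ?S"
    then have w: "w = v + vec_of_int (l - axis j 1)"
      by (auto simp: vec_of_int_diff vec_of_int_axis algebra_simps)
    show "l - axis j 1 \<in> {l. l \<in> relation_set a (u - a j) \<and> v + vec_of_int l = w}"
      using l w relation_set_add_axis[of "l - axis j 1" j a u] by simp
    show "?c (l - axis j 1) k
        = (w $ j + 1) * ?c l k + of_nat (k $ j + 1) * ?c l (k + axis j 1)"
      using partial_f_prod_coeff[of v "l - axis j 1" j "count_list P" k]
      unfolding w by simp
  qed (auto simp: vec_of_int_add vec_of_int_axis relation_set_add_axis add.assoc)
  finally show "partial j (Psi a v u P) w k = Psi a v (u - a j) P w k"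
    by (simp only: Psi_altdef)
qed

definition Psi_comb ::
  "('n::finite \<Rightarrow> int ^ 'd) \<Rightarrow> complex ^ 'n \<Rightarrow> ('n list \<Rightarrow> complex) \<Rightarrow> 'n list set \<Rightarrow> int ^ 'd
     \<Rightarrow> 'n logseries" where
  "Psi_comb a v c S u = (\<lambda>w k. \<Sum>P\<in>S. c P * Psi a v u P w k)"

lemma partial_Psi_comb: "partial j (Psi_comb a v c S u) = Psi_comb a v c S (u - a j)"
proof -
  have "partial j (Psi_comb a v c S u) w k = (\<Sum>P\<in>S. c P * partial j (Psi a v u P) w k)" for w k
    by (simp add: partial_def Psi_comb_def sum_distrib_left distrib_left sum.distrib mult_ac)
  then show ?thesis by (simp add: fun_eq_iff partial_Psi Psi_comb_def)
qed

lemma partial_power_Psi_comb: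
  "partial_power m (Psi_comb a v c S u)
     = Psi_comb a v c S (u - (\<Sum>j\<in>UNIV. int (m $ j) *s a j))"
proof -
  have pow: "(partial j ^^ b) (Psi_comb a v c S u') = Psi_comb a v c S (u' - int b *s a j)"
    for j b u'
    by (induction b)
      (simp_all add: partial_Psi_comb vector_sadd_rdistrib algebra_simps)
  interpret comp_fun_commute "\<lambda>j. partial j ^^ (m $ j)"
    by (rule partial_power_comp_fun_commute)
  have "Finite_Set.fold (\<lambda>j. partial j ^^ (m $ j)) (Psi_comb a v c S u) A
      = Psi_comb a v c S (u - (\<Sum>j\<in>A. int (m $ j) *s a j))" if "finite A" for A
    using that
    by (induction A) (simp_all add: pow algebra_simps)
  then show ?thesis by (simp add: partial_power_def)
qed

lemma box_op_Psi_comb: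
  assumes "l \<in> relation_set a 0"
  shows "box_op l (Psi_comb a v c S u) w k = 0"
proof -
  have "(\<Sum>j\<in>UNIV. int (nat (l $ j)) *s a j) - (\<Sum>j\<in>UNIV. int (nat (- (l $ j))) *s a j)
      = (\<Sum>j\<in>UNIV. l $ j *s a j)"
    unfolding sum_subtractf[symmetric] by (rule sum.cong) (auto simp: vec_eq_iff)
  also have "\<dots> = 0" using assms by (simp add: relation_set_def)
  finally show ?thesis
    by (simp add: box_op_def partial_power_Psi_comb)
qed

lemma poly_in_logs_Psi_comb:
  assumes "finite S"
  shows "poly_in_logs (Psi_comb a v c S u)"
  unfolding poly_in_logs_def
proof
  fix w
  show "finite {k. Psi_comb a v c S u w k \<noteq> 0}"
  proof (cases "\<exists>l. l \<in> relation_set a u \<and> w = v + vec_of_int l")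
    case False
    then show ?thesis by (simp add: Psi_comb_def Psi_outside)
  next
    case True
    then obtain l where l: "l \<in> relation_set a u" and w: "w = v + vec_of_int l" by blast
    have fin: "finite {k. f_prod_coeff v \<rho> l k \<noteq> 0}" for \<rho>
    proof (rule finite_subset)
      let ?d = "\<lambda>i. degree (f_poly (v $ i) (\<rho> i) (l $ i))"
      show "{k. f_prod_coeff v \<rho> l k \<noteq> 0} \<subseteq> vec_lambda ` (\<Pi>\<^sub>E i\<in>UNIV. {..?d i})"
      proof
        fix k assume "k \<in> {k. f_prod_coeff v \<rho> l k \<noteq> 0}"
        then have "k $ i \<le> ?d i" for i
          by (auto simp: f_prod_coeff_def intro: le_degree)
        then have "vec_nth k \<in> (\<Pi>\<^sub>E i\<in>UNIV. {..?d i})" by auto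
        then show "k \<in> vec_lambda ` (\<Pi>\<^sub>E i\<in>UNIV. {..?d i})"
          by (metis image_eqI vec_nth_inverse)
      qed
      show "finite (vec_lambda ` (\<Pi>\<^sub>E i\<in>UNIV. {..?d i}))"
        by (intro finite_imageI finite_PiE) simp_all
    qed
    have "{k. Psi_comb a v c S u w k \<noteq> 0}
        \<subseteq> (\<Union>P\<in>S. {k. f_prod_coeff v (count_list P) l k \<noteq> 0})"
      by (auto simp: Psi_comb_def w Psi_at[OF l] dest: sum.not_neutral_contains_not_neutral)
    then show ?thesis
      by (rule finite_subset) (use assms fin in auto)
  qed
qed

section \<open>Deleting an entry of a sequence\<close>

lemma sum_lists_Suc:
  fixes g :: "'a::finite list \<Rightarrow> 'b::comm_monoid_add"
  shows "(\<Sum>P | length P = Suc r. g P) = (\<Sum>p\<in>UNIV. \<Sum>Q | length Q = r. g (p # Q))"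
proof -
  have "(\<Sum>P | length P = Suc r. g P) = (\<Sum>(p, Q)\<in>UNIV \<times> {Q. length Q = r}. g (p # Q))"
    by (rule sum.reindex_bij_witness[of _ "\<lambda>(p, Q). p # Q" "\<lambda>P. (hd P, tl P)"])
      (auto simp: length_Suc_conv)
  then show ?thesis by (simp add: sum.cartesian_product)
qed

text \<open>Think of \<open>T \<rho>\<close> as the monomial \<open>\<Prod>\<^sub>i y\<^sub>i\<^bsup>\<rho> i\<^esup>\<close>: the sum over the lists is then the product of
  the linear forms \<open>\<Sum>\<^sub>p \<lambda>\<^sub>k(p) y\<^sub>p\<close>, and the lemma states that the derivation
  \<open>\<Sum>\<^sub>j \<alpha>\<^sub>j \<partial>/\<partial>y\<^sub>j\<close>, which kills each form, kills their product. The induction is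
  the product rule.\<close>

lemma sum_lists_delete_entry_eq_0:
  fixes \<alpha> :: "'n::finite \<Rightarrow> 'b::comm_ring_1" and lam :: "nat \<Rightarrow> 'n \<Rightarrow> 'b"
  assumes "\<And>k. k < r \<Longrightarrow> (\<Sum>p\<in>UNIV. lam k p * \<alpha> p) = 0"
  shows "(\<Sum>P | length P = r. (\<Prod>k<r. lam k (P ! k)) *
           (\<Sum>j\<in>UNIV. \<alpha> j * of_nat (count_list P j) *
              T ((count_list P)(j := count_list P j - 1)))) = 0"
  using assms
proof (induction r arbitrary: lam T)
  case 0
  show ?case by simp
next
  case (Suc r)
  let ?c = "\<lambda>Q. \<Prod>k<r. lam (Suc k) (Q ! k)"
  let ?D = "\<lambda>T Q. \<Sum>j\<in>UNIV. \<alpha> j * of_nat (count_list Q j) *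
                       T ((count_list Q)(j := count_list Q j - 1))"
  \<comment> \<open>Prepending \<open>p\<close> multiplies the monomial by \<open>y\<^sub>p\<close>.\<close>
  let ?T = "\<lambda>p \<rho>. T (\<rho>(p := Suc (\<rho> p)))"
  have step: "?D T (p # Q) = \<alpha> p * T (count_list Q) + ?D (?T p) Q" for p Q
  proof -
    have "\<alpha> j * of_nat (count_list (p # Q) j) *
            T ((count_list (p # Q))(j := count_list (p # Q) j - 1))
        = (if j = p then \<alpha> p * T (count_list Q) else 0) +
          \<alpha> j * of_nat (count_list Q j) * ?T p ((count_list Q)(j := count_list Q j - 1))" for j
    proof (cases "j = p")
      case True
      have 1: "(count_list (p # Q))(p := count_list (p # Q) p - 1) = count_list Q"
        by (auto simp: fun_eq_iff)
      have 2: "of_nat (count_list Q p) * ?T p ((count_list Q)(p := count_list Q p - 1))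
          = of_nat (count_list Q p) * T (count_list Q)"
        by (cases "count_list Q p") (simp_all add: fun_upd_idem)
      show ?thesis
        unfolding True 1 mult.assoc 2 by (simp add: algebra_simps)
    next
      case False
      then have "(count_list (p # Q))(j := count_list (p # Q) j - 1)
          = ((count_list Q)(j := count_list Q j - 1))
              (p := Suc (((count_list Q)(j := count_list Q j - 1)) p))"
        by (auto simp: fun_eq_iff)
      then show ?thesis using False by simp
    qed
    then show ?thesis by (simp add: sum.distrib)
  qed
  have "(\<Sum>P | length P = Suc r. (\<Prod>k<Suc r. lam k (P ! k)) * ?D T P)
      = (\<Sum>p\<in>UNIV. \<Sum>Q | length Q = r. lam 0 p * ?c Q * ?D T (p # Q))"
    by (simp only: sum_lists_Suc prod.lessThan_Suc_shift nth_Cons_0 nth_Cons_Suc)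
  also have "\<dots> = (\<Sum>p\<in>UNIV. lam 0 p * \<alpha> p * (\<Sum>Q | length Q = r. ?c Q * T (count_list Q))
                          + lam 0 p * (\<Sum>Q | length Q = r. ?c Q * ?D (?T p) Q))"
    unfolding step by (simp only: sum_distrib_left sum.distrib distrib_left mult_ac)
  also have "\<dots> = (\<Sum>p\<in>UNIV. lam 0 p * \<alpha> p * (\<Sum>Q | length Q = r. ?c Q * T (count_list Q)))"
  proof (rule sum.cong[OF refl])
    fix p
    have "(\<Sum>Q | length Q = r. ?c Q * ?D (?T p) Q) = 0"
      by (rule Suc.IH) (use Suc.prems in simp)
    then show "lam 0 p * \<alpha> p * (\<Sum>Q | length Q = r. ?c Q * T (count_list Q))
                + lam 0 p * (\<Sum>Q | length Q = r. ?c Q * ?D (?T p) Q)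
             = lam 0 p * \<alpha> p * (\<Sum>Q | length Q = r. ?c Q * T (count_list Q))"
      by simp
  qed
  also have "\<dots> = 0"
    using Suc.prems[of 0] by (simp add: sum_distrib_right[symmetric])
  finally show ?case .
qed

section \<open>Euler operators\<close>

lemma mult_x_partial:
  "mult_x j (partial j F) w k = w $ j * F w k + of_nat (k $ j + 1) * F w (k + axis j 1)"
  by (simp add: mult_x_def partial_def)

lemma euler_op_altdef:
  "euler_op a \<gamma> i F w k =
     ((\<Sum>j\<in>UNIV. of_int (a j $ i) * w $ j) - \<gamma> $ i) * F w k
     + (\<Sum>j\<in>UNIV. of_int (a j $ i) * (of_nat (k $ j + 1) * F w (k + axis j 1)))"
  by (simp add: euler_op_def mult_x_partial distrib_left sum.distrib sum_distrib_right
      left_diff_distrib mult.assoc)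

lemma exponent_degree:
  assumes "(\<Sum>i\<in>UNIV. v $ i *s vec_of_int (a i)) = \<beta>" and "l \<in> relation_set a u"
  shows "(\<Sum>j\<in>UNIV. of_int (a j $ i) * (v + vec_of_int l) $ j) = (\<beta> + vec_of_int u) $ i"
proof -
  have "\<beta> $ i = (\<Sum>j\<in>UNIV. v $ j * of_int (a j $ i))"
    by (simp add: assms(1)[symmetric] vec_of_int_def)
  moreover have "u $ i = (\<Sum>j\<in>UNIV. l $ j * a j $ i)"
    using assms(2) by (auto simp: relation_set_def)
  ultimately show ?thesis
    by (simp add: vec_of_int_def distrib_left sum.distrib mult.commute)
qed

text \<open>Outside the set \<open>Z\<close> of the conclusion, a negative integer coordinate of \<open>v + l\<close> was already one
  of \<open>v\<close>. As \<open>i0\<close> is lost from the negative support, minimality fails for \<open>I = - Z\<close>, so this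
  \<open>I\<close> must be too small for the hypothesis.\<close>

lemma card_new_negatives:
  fixes v :: "complex ^ 'n::finite"
  assumes min: "\<And>I. CARD('n) \<le> card I + r \<Longrightarrow> minimal_neg_support a I u v"
    and l: "l \<in> relation_set a u"
    and i0: "v $ i0 = of_int m0" "m0 < 0" "0 \<le> m0 + l $ i0"
  shows "r < card {i. \<exists>m::int. v $ i = of_int m \<and> 0 \<le> m \<and> m + l $ i < 0}" (is "r < card ?Z")
proof (rule ccontr)
  assume "\<not> r < card ?Z"
  moreover have "card (- ?Z) = CARD('n) - card ?Z" by (simp add: Compl_eq_Diff_UNIV card_Diff_subset)
  ultimately have "minimal_neg_support a (- ?Z) u v" by (intro min) linarith
  then have not_sub: "\<not> nsupp (- ?Z) (v + vec_of_int l) \<subset> nsupp (- ?Z) v"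
    using l by (simp add: minimal_neg_support_def)
  have "nsupp (- ?Z) (v + vec_of_int l) \<subseteq> nsupp (- ?Z) v"
  proof
    fix i assume "i \<in> nsupp (- ?Z) (v + vec_of_int l)"
    then obtain m :: int where i: "i \<notin> ?Z" and m: "m < 0"
      and "v $ i + of_int (l $ i) = of_int m"
      by (auto simp: nsupp_def vec_of_int_def)
    then have vi: "v $ i = of_int (m - l $ i)" by (simp add: algebra_simps)
    have "m - l $ i < 0"
    proof (rule ccontr)
      assume "\<not> m - l $ i < 0"
      with vi m have "i \<in> ?Z" by (intro CollectI exI[of _ "m - l $ i"]) simp
      with i show False ..
    qed
    then show "i \<in> nsupp (- ?Z) v" using i vi by (auto simp: nsupp_def simp del: of_int_diff)
  qed
  moreover have "i0 \<in> nsupp (- ?Z) v"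
    using i0 by (auto simp: nsupp_def)
  moreover have "i0 \<notin> nsupp (- ?Z) (v + vec_of_int l)"
    using i0 by (auto simp: nsupp_def vec_of_int_def simp flip: of_int_add)
  ultimately show False using not_sub by blast
qed

lemma f_prod_coeff_pderiv:
  assumes "\<And>m::int. v $ j = of_int m \<Longrightarrow> m < 0 \<Longrightarrow> m + l $ j < 0"
  shows "of_nat (k $ j + 1) * f_prod_coeff v \<rho> l (k + axis j 1)
           = of_nat (\<rho> j) * f_prod_coeff v (\<rho>(j := \<rho> j - 1)) l k"
proof -
  let ?R = "\<Prod>i\<in>UNIV - {j}. coeff (f_poly (v $ i) (\<rho> i) (l $ i)) (k $ i)"
  have 1: "f_prod_coeff v \<rho> l (k + axis j 1)
      = coeff (f_poly (v $ j) (\<rho> j) (l $ j)) (Suc (k $ j)) * ?R"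
    by (subst f_prod_coeff_remove[of _ _ _ _ j])
      (auto simp: axis_def intro!: arg_cong2[where f = "(*)"] prod.cong)
  have 2: "f_prod_coeff v (\<rho>(j := \<rho> j - 1)) l k
      = coeff (f_poly (v $ j) (\<rho> j - 1) (l $ j)) (k $ j) * ?R"
    by (subst f_prod_coeff_remove[of _ _ _ _ j])
      (auto intro!: arg_cong2[where f = "(*)"] prod.cong)
  have "of_nat (k $ j + 1) * coeff (f_poly (v $ j) (\<rho> j) (l $ j)) (Suc (k $ j))
      = coeff (pderiv (f_poly (v $ j) (\<rho> j) (l $ j))) (k $ j)"
    by (simp add: coeff_pderiv)
  also have "\<dots> = of_nat (\<rho> j) * coeff (f_poly (v $ j) (\<rho> j - 1) (l $ j)) (k $ j)"
    by (simp add: pderiv_f_poly[OF assms])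
  finally show ?thesis unfolding 1 2 by (simp only: mult.assoc[symmetric])
qed

text \<open>In the combination of the \<open>\<Psi>\<^sup>P\<close>, the logarithmic polynomial multiplying \<open>x\<^bsup>v+l\<^esup>\<close> is annihilated by the derivation
  \<open>\<Sum>\<^sub>j a\<^sub>i\<^sub>j \<partial>/\<partial>log x\<^sub>j\<close>.\<close>

lemma sum_f_prod_coeff_eq_0:
  fixes a :: "'n::finite \<Rightarrow> int ^ 'd::finite" and v :: "complex ^ 'n"
  assumes min: "\<And>I. CARD('n) \<le> card I + r \<Longrightarrow> minimal_neg_support a I u v"
    and ls: "\<And>k. k < r \<Longrightarrow> ls k \<in> relation_set a 0"
    and l: "l \<in> relation_set a u"
  shows "(\<Sum>P | length P = r. (\<Prod>q<r. of_int (ls q $ (P ! q))) *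
           (\<Sum>j\<in>UNIV. of_int (a j $ i) *
              (of_nat (k $ j + 1) * f_prod_coeff v (count_list P) l (k + axis j 1)))) = 0"
proof (cases "\<forall>j. \<forall>m::int. v $ j = of_int m \<longrightarrow> m < 0 \<longrightarrow> m + l $ j < 0")
  case True
  have "(\<Sum>p\<in>UNIV. of_int (ls q $ p) * of_int (a p $ i) :: complex) = 0" if "q < r" for q
  proof -
    have "(\<Sum>p\<in>UNIV. ls q $ p *s a p) $ i = 0"
      using ls[OF that] by (simp add: relation_set_def)
    then have "of_int (\<Sum>p\<in>UNIV. ls q $ p * a p $ i) = (0 :: complex)" by simp
    then show ?thesis by simp
  qed
  then have "(\<Sum>P | length P = r. (\<Prod>q<r. of_int (ls q $ (P ! q))) *
      (\<Sum>j\<in>UNIV. of_int (a j $ i) * of_nat (count_list P j) *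
         f_prod_coeff v ((count_list P)(j := count_list P j - 1)) l k)) = 0"
    by (rule sum_lists_delete_entry_eq_0[of r "\<lambda>q p. of_int (ls q $ p)" _
          "\<lambda>\<rho>. f_prod_coeff v \<rho> l k"])
  moreover have "of_nat (k $ j + 1) * f_prod_coeff v (count_list P) l (k + axis j 1)
      = of_nat (count_list P j) * f_prod_coeff v ((count_list P)(j := count_list P j - 1)) l k"
    for j P
    by (rule f_prod_coeff_pderiv) (use True in blast)
  ultimately show ?thesis by (simp only: mult.assoc)
next
  case False
  let ?Z = "{i. \<exists>m::int. v $ i = of_int m \<and> 0 \<le> m \<and> m + l $ i < 0}"
  from False obtain i0 m0 where i0: "v $ i0 = of_int m0" "m0 < 0" "0 \<le> m0 + l $ i0"
    by (auto simp: not_less)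
  have card: "r < card ?Z" by (rule card_new_negatives[OF min l i0])
  have "f_prod_coeff v (count_list P) l k' = 0" if "length P = r" for P k'
  proof -
    have "card (set P) < card ?Z" using card card_length[of P] that by linarith
    then have "\<not> ?Z \<subseteq> set P" using card_mono[of "set P" ?Z] by fastforce
    then obtain i where "i \<in> ?Z" and "i \<notin> set P" by blast
    then have "f_poly (v $ i) (count_list P i) (l $ i) = 0"
      by (auto simp: count_list_0_iff f_poly_no_log_eq_0)
    then show ?thesis
      by (simp add: f_prod_coeff_remove[of v "count_list P" l k' i])
  qed
  then show ?thesis by simp
qed

theorem theorem5p22:
  fixes a :: "'n::finite \<Rightarrow> int ^ 'd::finite"
    and \<beta> :: "complex ^ 'd"
    and v :: "complex ^ 'n"
    and u :: "int ^ 'd"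
    and r :: nat
    and ls :: "nat \<Rightarrow> int ^ 'n"
  assumes "(\<Sum>i\<in>UNIV. v $ i *s vec_of_int (a i)) = \<beta>"
    and "u \<in> group_closure (range a)"
    and "\<And>I. CARD('n) \<le> card I + r \<Longrightarrow> minimal_neg_support a I u v"
    and "\<And>k. k < r \<Longrightarrow> ls k \<in> relation_set a 0"
  shows "hypergeometric_solution a (\<beta> + vec_of_int u)
           (\<lambda>w m. \<Sum>P | length P = r. (\<Prod>k<r. of_int (ls k $ (P ! k))) * Psi a v u P w m)"
proof -
  let ?c = "\<lambda>P. \<Prod>k<r. of_int (ls k $ (P ! k)) :: complex"
  let ?S = "{P :: 'n list. length P = r}"
  let ?F = "Psi_comb a v ?c ?S u"
  have "finite ?S" using finite_lists_length_eq[of "UNIV :: 'n set" r] by simp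
  then have "poly_in_logs ?F" by (rule poly_in_logs_Psi_comb)
  moreover have "euler_op a (\<beta> + vec_of_int u) i ?F w k = 0" for i w k
  proof (cases "\<exists>l. l \<in> relation_set a u \<and> w = v + vec_of_int l")
    case False
    then show ?thesis by (simp add: euler_op_altdef Psi_comb_def Psi_outside)
  next
    case True
    then obtain l where l: "l \<in> relation_set a u" and w: "w = v + vec_of_int l" by blast
    have F: "?F w k' = (\<Sum>P\<in>?S. ?c P * f_prod_coeff v (count_list P) l k')" for k'
      by (simp add: Psi_comb_def w Psi_at[OF l])
    have "euler_op a (\<beta> + vec_of_int u) i ?F w k
        = (\<Sum>j\<in>UNIV. of_int (a j $ i) * (of_nat (k $ j + 1) * ?F w (k + axis j 1)))"
      unfolding euler_op_altdef w exponent_degree[OF assms(1) l] by simp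
    also have "\<dots> = (\<Sum>P\<in>?S. ?c P * (\<Sum>j\<in>UNIV. of_int (a j $ i) *
        (of_nat (k $ j + 1) * f_prod_coeff v (count_list P) l (k + axis j 1))))"
      unfolding F sum_distrib_left by (subst sum.swap) (simp only: mult_ac)
    also have "\<dots> = 0" by (rule sum_f_prod_coeff_eq_0[OF assms(3,4) l])
    finally show ?thesis .
  qed
  ultimately have "hypergeometric_solution a (\<beta> + vec_of_int u) ?F"
    by (simp add: hypergeometric_solution_def box_op_Psi_comb)
  then show ?thesis by (simp only: Psi_comb_def)
qed

end
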